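(* Let $k\ge2$, and let $\theta_1,\dots,\theta_k,\tau,\beta$ be real numbers with $(k+1)/(k+2)\le\beta\le1$, $\tau\ne0$ and $\theta_k\ne0$. Let $\rho=\beta+2\pi i\tau$ and let $X\ge1$ be real. Then \[ I(X;\boldsymbol\theta,\rho)=\int_0^X e(\theta_1x+\cdots+\theta_kx^k)\,x^{\rho-1}\,dx \] satisfies \[ I(X;\boldsymbol\theta,\rho)\ll\frac{X^\beta}{\bigl(1+X|\theta_1|+\cdots+X^k|\theta_k|+|\tau|\bigr)^{1/(1+k)}}. \]
   Context: $e(\alpha)=e^{2\pi i\alpha}$. *)

theory Defs
  imports "HOL-Analysis.Analysis"
begin

definition unit_exp :: "real \<Rightarrow> complex" where
  "unit_exp \<alpha> = exp (2 * of_real pi * \<i> * of_real \<alpha>)"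

text \<open>
  Only the values \<open>\<theta> 1, \<dots>, \<theta> k\<close> matter. For \<open>Re \<rho> > 0\<close> the integrand is
  absolutely integrable; its value at the possible singularity \<open>x = 0\<close> is irrelevant.
\<close>
definition osc_integral :: "nat \<Rightarrow> real \<Rightarrow> (nat \<Rightarrow> real) \<Rightarrow> complex \<Rightarrow> complex" where
  "osc_integral k X \<theta> \<rho> =
     integral {0..X} (\<lambda>x. unit_exp (\<Sum>j=1..k. \<theta> j * x ^ j) * of_real x powr (\<rho> - 1))"

end

theory Submission
  imports Defs "HOL-Computational_Algebra.Polynomial"
begin

text \<open>
  The substitution \<open>x = X u powr (1 / \<beta>)\<close> turns the integral into \<open>X powr \<beta> / \<beta>\<close> times an integral
  of \<open>cis (\<psi> u)\<close> over \<open>(0, 1)\<close>, where \<open>\<psi>' u\<close> is proportional to \<open>Q u = P (u powr (1 / \<beta>)) / u\<close> and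
  \<open>P\<close> is the polynomial with coefficients \<open>\<tau>\<close> and \<open>j X ^ j \<theta> j\<close>. Let \<open>L\<close> be the sum of their absolute
  values and \<open>y = L powr (- 1 / (k + 1))\<close>. The set where \<open>\<bar>y Q\<bar> < 1\<close> has measure \<open>O(y)\<close>: from \<open>k + 1\<close>
  well separated points in it, Lagrange interpolation would make the coefficients of \<open>P\<close> too small
  (this is where \<open>\<beta> \<ge> k / (k + 1)\<close> enters). Elsewhere \<open>\<bar>\<psi>'\<bar>\<close> is at least of order \<open>1 / y\<close>, and \<open>Q\<close> is
  monotone on at most \<open>k + 1\<close> intervals, so the second mean value theorem gives \<open>O(y)\<close> again.
\<close>

section \<open>Coverings by short intervals and splitting at breakpoints\<close>

text \<open>The bound on \<open>card T\<close> lets a separated set of maximal cardinality be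
  chosen; a point of \<open>E\<close> further than \<open>m\<close> from all its elements could
  still be added. This turns a count of separated points into a bound on measure.\<close>

lemma separated_cover:
  fixes E :: "real set"
  assumes "m > 0"
    and sep: "\<And>T. finite T \<Longrightarrow> T \<subseteq> E \<Longrightarrow> (\<And>s t. s \<in> T \<Longrightarrow> t \<in> T \<Longrightarrow> s \<noteq> t \<Longrightarrow> m \<le> \<bar>s - t\<bar>) \<Longrightarrow> card T \<le> n"
  obtains T where "finite T" "card T \<le> n" "E \<subseteq> (\<Union>t\<in>T. {t - m..t + m})"
proof -
  define P where "P T \<longleftrightarrow> finite T \<and> T \<subseteq> E \<and> (\<forall>s\<in>T. \<forall>t\<in>T. s \<noteq> t \<longrightarrow> m \<le> \<bar>s - t\<bar>)" for T
  have bound: "card T \<le> n" if "P T" for T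
    using that sep unfolding P_def by blast
  have "P {}" by (simp add: P_def)
  then obtain T where T: "P T" and T_max: "\<And>T'. P T' \<Longrightarrow> card T' \<le> card T"
    using ex_has_greatest_nat[of P "{}" card "Suc n"] bound by (auto simp: less_Suc_eq_le)
  have "x \<in> (\<Union>t\<in>T. {t - m..t + m})" if "x \<in> E" for x
  proof (rule ccontr)
    assume "\<not> ?thesis"
    then have far: "m < \<bar>x - t\<bar>" if "t \<in> T" for t
      using that by (force simp: abs_if)
    then have "x \<notin> T" using \<open>m > 0\<close> by force
    have "P (insert x T)"
      using T that far unfolding P_def by (force simp: abs_minus_commute less_imp_le)
    then have "card (insert x T) \<le> card T" by (rule T_max)
    then show False using T \<open>x \<notin> T\<close> by (simp add: P_def)
  qed
  then have "E \<subseteq> (\<Union>t\<in>T. {t - m..t + m})" by (rule subsetI)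
  then show thesis using that[of T] T bound[OF T] unfolding P_def by blast
qed

text \<open>The sum of the indicators of the covering intervals dominates
  \<open>\<bar>h\<bar>\<close>, and each has integral at most \<open>2 * m\<close>; overlaps only
  enlarge the sum.\<close>

lemma integral_bound_on_cover:
  fixes h :: "real \<Rightarrow> real"
  assumes h: "h integrable_on {a..b}" and "finite T" "card T \<le> n" "m > 0"
    and le1: "\<And>u. u \<in> {a..b} \<Longrightarrow> \<bar>h u\<bar> \<le> 1"
    and supp: "\<And>u. u \<in> {a..b} \<Longrightarrow> u \<notin> (\<Union>t\<in>T. {t - m..t + m}) \<Longrightarrow> h u = 0"
  shows "\<bar>integral {a..b} h\<bar> \<le> 2 * m * real n"
proof -
  define I where "I t u = (indicat_real {t - m..t + m} u)" for t u
  have hasI: "(I t has_integral integral {a..b} (I t)) {a..b}"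
    and I_le: "integral {a..b} (I t) \<le> 2 * m" for t
  proof -
    have 0: "(I t has_integral (2 * m)) UNIV"
    proof -
      have "((\<lambda>u. 1::real) has_integral (2*m)) {t - m..t + m}"
        using has_integral_const_real[of "1::real" "t - m" "t + m"] \<open>m > 0\<close> by simp
      then have "((\<lambda>u. if u \<in> {t - m..t + m} then 1 else 0 :: real) has_integral 2 * m) UNIV"
        by (simp only: has_integral_restrict_UNIV)
      moreover have "I t = (\<lambda>u. if u \<in> {t - m..t + m} then 1 else 0)"
        by (auto simp: I_def)
      ultimately show ?thesis by simp
    qed
    have i: "I t integrable_on {a..b}"
      by (rule integrable_on_subinterval[of _ UNIV]) (use 0 in auto)
    then show "(I t has_integral integral {a..b} (I t)) {a..b}" by (rule integrable_integral)
    have "integral {a..b} (I t) \<le> integral UNIV (I t)"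
      by (rule integral_subset_le) (use i 0 in \<open>auto simp: I_def\<close>)
    then show "integral {a..b} (I t) \<le> 2 * m" using 0 by (simp add: integral_unique)
  qed
  have "norm (integral {a..b} h) \<le> integral {a..b} (\<lambda>u. \<Sum>t\<in>T. I t u)"
  proof (rule integral_norm_bound_integral[OF h])
    show "(\<lambda>u. \<Sum>t\<in>T. I t u) integrable_on {a..b}"
      using \<open>finite T\<close> hasI by (intro integrable_sum) auto
    fix u assume u: "u \<in> {a..b}"
    show "norm (h u) \<le> (\<Sum>t\<in>T. I t u)"
    proof (cases "u \<in> (\<Union>t\<in>T. {t - m..t + m})")
      case True
      then obtain t where "t \<in> T" "I t u = 1" by (auto simp: I_def)
      then have "1 \<le> (\<Sum>t\<in>T. I t u)"
        using member_le_sum[of t T "\<lambda>t. I t u"] \<open>finite T\<close> by (auto simp: I_def)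
      then show ?thesis using le1[OF u] by simp
    qed (use supp[OF u] in \<open>auto simp: I_def intro!: sum_nonneg\<close>)
  qed
  also have "\<dots> = (\<Sum>t\<in>T. integral {a..b} (I t))"
    using \<open>finite T\<close> hasI by (intro integral_sum) auto
  also have "\<dots> \<le> card T * (2 * m)"
    using sum_bounded_above[of T "\<lambda>t. integral {a..b} (I t)" "2 * m"] I_le by simp
  also have "\<dots> \<le> 2 * m * real n"
    using assms by simp
  finally show ?thesis by simp
qed

text \<open>Induction on the number of breakpoints strictly inside the interval. Splitting at a
  breakpoint \<open>z\<close> turns it into an endpoint, so neither half counts it again.\<close>

lemma integral_bound_by_breakpoints:
  fixes f :: "real \<Rightarrow> real"
  assumes "finite Z" "a \<le> b" "f integrable_on {a..b}"
    and "\<And>c d. a \<le> c \<Longrightarrow> c \<le> d \<Longrightarrow> d \<le> b \<Longrightarrow> Z \<inter> {c<..<d} = {} \<Longrightarrow> \<bar>integral {c..d} f\<bar> \<le> K"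
  shows "\<bar>integral {a..b} f\<bar> \<le> (real (card (Z \<inter> {a<..<b})) + 1) * K"
  using assms(2-)
proof (induction "card (Z \<inter> {a<..<b})" arbitrary: a b rule: less_induct)
  case less
  show ?case
  proof (cases "Z \<inter> {a<..<b} = {}")
    case True
    then show ?thesis using less.prems(1) less.prems(3)[of a b] by simp
  next
    case False
    then obtain z where z: "z \<in> Z" "a < z" "z < b" by auto
    \<comment> \<open>The degenerate interval from \<open>a\<close> to \<open>a\<close> contains no
      breakpoint and has integral 0.\<close>
    have K: "0 \<le> K" using less.prems(1) less.prems(3)[of a a] by simp
    let ?A = "Z \<inter> {a<..<z}" and ?B = "Z \<inter> {z<..<b}"
    have "card ?A + card ?B = card (?A \<union> ?B)"
      using \<open>finite Z\<close> by (intro card_Un_disjoint[symmetric]) auto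
    moreover have "Suc (card (?A \<union> ?B)) = card (insert z (?A \<union> ?B))"
      using \<open>finite Z\<close> by (subst card_insert_disjoint) auto
    moreover have "card (insert z (?A \<union> ?B)) \<le> card (Z \<inter> {a<..<b})"
      using \<open>finite Z\<close> z by (intro card_mono) auto
    ultimately have c: "card ?A + card ?B + 1 \<le> card (Z \<inter> {a<..<b})" by simp
    have f: "f integrable_on {a..z}" "f integrable_on {z..b}"
      using less.prems(2) z by (auto intro: integrable_on_subinterval)
    have "\<bar>integral {a..z} f\<bar> \<le> (real (card ?A) + 1) * K"
      using c z f less.prems(3) by (intro less.hyps) auto
    moreover have "\<bar>integral {z..b} f\<bar> \<le> (real (card ?B) + 1) * K"
      using c z f less.prems(3) by (intro less.hyps) auto
    moreover have "integral {a..b} f = integral {a..z} f + integral {z..b} f"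
      using z less.prems(2) by (intro Henstock_Kurzweil_Integration.integral_combine[symmetric]) auto
    ultimately have "\<bar>integral {a..b} f\<bar> \<le> (real (card ?A + card ?B + 1) + 1) * K"
      by (simp add: algebra_simps)
    also have "\<dots> \<le> (real (card (Z \<inter> {a<..<b})) + 1) * K"
      using c K by (intro mult_right_mono) linarith+
    finally show ?thesis .
  qed
qed

section \<open>Oscillatory integrals with monotone weights\<close>

text \<open>The second mean value theorem writes the integral as \<open>g c\<close> times one
  increment of \<open>f\<close> plus \<open>g d\<close> times another, and each increment is at most
  2 in absolute value. An antitone \<open>g\<close> is replaced by its negative.\<close>

lemma mono_integral_bound:
  fixes f g h :: "real \<Rightarrow> real"
  assumes "c \<le> d"
    and f: "\<And>x. x \<in> {c..d} \<Longrightarrow> (f has_real_derivative f' x) (at x)"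
    and f1: "\<And>x. x \<in> {c..d} \<Longrightarrow> \<bar>f x\<bar> \<le> 1"
    and g1: "\<And>x. x \<in> {c..d} \<Longrightarrow> \<bar>g x\<bar> \<le> 1"
    and mono: "mono_on {c..d} g \<or> antimono_on {c..d} g"
  shows "\<bar>integral {c..d} (\<lambda>x. g x * f' x)\<bar> \<le> 4"
proof -
  have ftc: "(f' has_integral (f y - f x)) {x..y}" if "x \<in> {c..d}" "y \<in> {c..d}" "x \<le> y" for x y
    using that f
    by (intro fundamental_theorem_of_calculus)
       (auto simp flip: has_real_derivative_iff_has_vector_derivative intro: has_field_derivative_at_within)
  have main: "\<bar>integral {c..d} (\<lambda>x. g x * f' x)\<bar> \<le> 4"
    if "mono_on {c..d} g" and g1: "\<And>x. x \<in> {c..d} \<Longrightarrow> \<bar>g x\<bar> \<le> 1" for g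
  proof -
    have "f' integrable_on {c..d}" using ftc[of c d] \<open>c \<le> d\<close> by auto
    moreover have "g x \<le> g y" if "c \<le> x" "x \<le> y" "y \<le> d" for x y
      using \<open>mono_on {c..d} g\<close> that by (auto simp: mono_on_def)
    ultimately obtain \<xi> where \<xi>: "\<xi> \<in> {c..d}" and
      eq: "integral {c..d} (\<lambda>x. g x * f' x) = g c * integral {c..\<xi>} f' + g d * integral {\<xi>..d} f'"
      using second_mean_value_theorem[of f' c d g] \<open>c \<le> d\<close> by blast
    have "\<bar>f \<xi> - f c\<bar> \<le> 2" "\<bar>f d - f \<xi>\<bar> \<le> 2"
      using f1[of \<xi>] f1[of c] f1[of d] \<xi> by auto
    then have "\<bar>g c * (f \<xi> - f c)\<bar> \<le> 1 * 2" "\<bar>g d * (f d - f \<xi>)\<bar> \<le> 1 * 2"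
      unfolding abs_mult using g1[of c] g1[of d] \<xi> by (intro mult_mono; auto)+
    moreover have int: "integral {c..\<xi>} f' = f \<xi> - f c" "integral {\<xi>..d} f' = f d - f \<xi>"
      using \<xi> by (intro integral_unique ftc; auto)+
    ultimately show ?thesis unfolding eq int by linarith
  qed
  show ?thesis
  proof (cases "mono_on {c..d} g")
    case False
    then have "antimono_on {c..d} g" using mono by simp
    then have "mono_on {c..d} (\<lambda>x. - g x)" by (auto simp: monotone_on_def)
    from main[OF this] g1 show ?thesis by simp
  qed (use main g1 in auto)
qed


text \<open>By the intermediate value theorem a continuous \<open>q'\<close> without zeros in the
  open interval keeps one sign there. Continuity of \<open>q\<close> carries monotonicity to the
  endpoints, where \<open>q'\<close> may vanish.\<close>

lemma mono_on_or_antimono_on_if_deriv_nonzero: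
  fixes q q' :: "real \<Rightarrow> real"
  assumes q: "\<And>x. x \<in> {c..d} \<Longrightarrow> (q has_real_derivative q' x) (at x)"
    and cont: "continuous_on {c..d} q'"
    and nz: "\<And>x. x \<in> {c<..<d} \<Longrightarrow> q' x \<noteq> 0"
  shows "mono_on {c..d} q \<or> antimono_on {c..d} q"
proof -
  have "is_interval (q' ` {c<..<d})"
    unfolding is_interval_connected_1
    by (intro connected_continuous_image continuous_on_subset[OF cont]) auto
  moreover have "0 \<notin> q' ` {c<..<d}" using nz by force
  ultimately have sign: "(\<forall>x\<in>{c<..<d}. 0 \<le> q' x) \<or> (\<forall>x\<in>{c<..<d}. 0 \<le> - q' x)"
  proof (cases "\<exists>x\<in>{c<..<d}. q' x < 0")
    case True
    then obtain x where x: "x \<in> {c<..<d}" "q' x < 0" by blast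
    have "q' z \<le> 0" if "z \<in> {c<..<d}" for z
    proof (rule ccontr)
      assume "\<not> q' z \<le> 0"
      then have "0 \<in> q' ` {c<..<d}"
        using mem_is_interval_1_I[OF \<open>is_interval (q' ` {c<..<d})\<close>, of "q' x" "q' z" 0] x that by simp
      with \<open>0 \<notin> q' ` {c<..<d}\<close> show False by blast
    qed
    then show ?thesis by auto
  next
    case False
    then show ?thesis by (auto simp: not_less)
  qed
  have cq: "continuous_on {c..d} q"
    by (rule DERIV_continuous_on, erule q[THEN has_field_derivative_at_within])
  have inc: "mono_on {c..d} r"
    if r: "\<And>x. x \<in> {c..d} \<Longrightarrow> (r has_real_derivative r' x) (at x)"
      and "\<forall>x\<in>{c<..<d}. 0 \<le> r' x" "continuous_on {c..d} r" for r r' :: "real \<Rightarrow> real"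
  proof (rule mono_onI)
    fix x y assume xy: "x \<in> {c..d}" "y \<in> {c..d}" "x \<le> y"
    show "r x \<le> r y"
    proof (rule DERIV_nonneg_imp_increasing_open[OF \<open>x \<le> y\<close>])
      show "\<exists>y. (r has_real_derivative y) (at z) \<and> 0 \<le> y" if "x < z" "z < y" for z
        using r[of z] that xy \<open>\<forall>x\<in>{c<..<d}. 0 \<le> r' x\<close> by (intro exI[of _ "r' z"]) auto
      show "continuous_on {x..y} r"
        using \<open>continuous_on {c..d} r\<close> xy by (auto elim: continuous_on_subset)
    qed
  qed
  from sign show ?thesis
  proof
    assume "\<forall>x\<in>{c<..<d}. 0 \<le> q' x"
    then show ?thesis using inc[of q q'] q cq by auto
  next
    assume "\<forall>x\<in>{c<..<d}. 0 \<le> - q' x"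
    moreover have "((\<lambda>x. - q x) has_real_derivative - q' x) (at x)" if "x \<in> {c..d}" for x
      using q[OF that] by (rule DERIV_minus)
    ultimately have "mono_on {c..d} (\<lambda>x. - q x)"
      using inc[of "\<lambda>x. - q x" "\<lambda>x. - q' x"] cq by (auto intro: continuous_on_minus)
    then show ?thesis by (auto simp: monotone_on_def)
  qed
qed

text \<open>
  Equal to \<open>v\<close> for \<open>\<bar>v\<bar> \<le> 1\<close> and to \<open>1 / v\<close> otherwise; this form exhibits it as a combination of three
  bounded monotone functions. The weight \<open>q * clamp_inv q\<close> removes the part of the integral with
  \<open>\<bar>q\<bar> < 1\<close> without counting the intervals that make up this set.
\<close>
definition clamp_inv :: "real \<Rightarrow> real" where
  "clamp_inv v = max (-1) (min 1 v) + 1 / max 1 v - 1 / max 1 (- v)"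

text \<open>These facts make \<open>1 - v * clamp_inv v\<close> a cutoff with values in [0, 1] that
  vanishes for \<open>1 \<le> \<bar>v\<bar>\<close>.\<close>

lemma clamp_inv_mult: "0 \<le> v * clamp_inv v" "v * clamp_inv v \<le> 1"
  and clamp_inv_large: "1 \<le> \<bar>v\<bar> \<Longrightarrow> v * clamp_inv v = 1"
proof -
  have small: "clamp_inv v = v" if "\<bar>v\<bar> \<le> 1"
    using that by (auto simp: clamp_inv_def max_def min_def)
  have large: "clamp_inv v = 1 / v" if "1 \<le> \<bar>v\<bar>"
    using that by (auto simp: clamp_inv_def max_def min_def field_simps)
  show "1 \<le> \<bar>v\<bar> \<Longrightarrow> v * clamp_inv v = 1"
    using large by auto
  then show "0 \<le> v * clamp_inv v" "v * clamp_inv v \<le> 1"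
    using small abs_square_le_1[of v] by (cases "1 \<le> \<bar>v\<bar>"; simp add: power2_eq_square)+
qed

lemma continuous_on_clamp_inv: "continuous_on UNIV clamp_inv"
  unfolding clamp_inv_def[abs_def] by (intro continuous_intros) auto

text \<open>Each of the three bounded monotone functions that make up \<open>clamp_inv\<close> stays
  monotone when composed with a monotone \<open>q\<close>, so \<open>mono_integral_bound\<close>
  applies to it at a cost of 4.\<close>

lemma integral_clamp_inv_bound:
  fixes f q :: "real \<Rightarrow> real"
  assumes "c \<le> d"
    and f: "\<And>x. x \<in> {c..d} \<Longrightarrow> (f has_real_derivative f' x) (at x)"
    and cont: "continuous_on {c..d} f'" "continuous_on {c..d} q"
    and f1: "\<And>x. x \<in> {c..d} \<Longrightarrow> \<bar>f x\<bar> \<le> 1"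
    and mono: "mono_on {c..d} q \<or> antimono_on {c..d} q"
  shows "\<bar>integral {c..d} (\<lambda>x. clamp_inv (q x) * f' x)\<bar> \<le> 12"
proof -
  define g1 g2 g3 :: "real \<Rightarrow> real"
    where "g1 v = max (-1) (min 1 v)" and "g2 v = 1 / max 1 v" and "g3 v = 1 / max 1 (- v)" for v
  have mono_g: "mono g1" "antimono g2" "mono g3"
    unfolding g1_def g2_def g3_def
    by (auto intro!: monoI antimonoI divide_left_mono simp: max_def min_def)
  have bound: "\<bar>g1 v\<bar> \<le> 1" "\<bar>g2 v\<bar> \<le> 1" "\<bar>g3 v\<bar> \<le> 1" for v
    unfolding g1_def g2_def g3_def by (auto simp: max_def min_def)
  have cont_g: "continuous_on UNIV g1" "continuous_on UNIV g2" "continuous_on UNIV g3"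
    unfolding g1_def[abs_def] g2_def[abs_def] g3_def[abs_def] by (intro continuous_intros; auto)+
  have B: "\<bar>integral {c..d} (\<lambda>x. g (q x) * f' x)\<bar> \<le> 4"
    if "mono g \<or> antimono g" "\<And>v. \<bar>g v\<bar> \<le> 1" for g :: "real \<Rightarrow> real"
  proof (rule mono_integral_bound[OF \<open>c \<le> d\<close> f f1])
    show "mono_on {c..d} (\<lambda>x. g (q x)) \<or> antimono_on {c..d} (\<lambda>x. g (q x))"
      using mono that(1) unfolding monotone_on_def by blast
  qed (use that in auto)
  have I: "(\<lambda>x. g (q x) * f' x) integrable_on {c..d}" if "continuous_on UNIV g" for g :: "real \<Rightarrow> real"
    using that cont by (intro integrable_continuous_real continuous_on_mult)
      (auto intro: continuous_on_compose2)
  have "(\<lambda>x. clamp_inv (q x) * f' x) = (\<lambda>x. g1 (q x) * f' x + g2 (q x) * f' x - g3 (q x) * f' x)"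
    by (simp add: clamp_inv_def g1_def g2_def g3_def algebra_simps)
  then have "integral {c..d} (\<lambda>x. clamp_inv (q x) * f' x) = integral {c..d} (\<lambda>x. g1 (q x) * f' x)
      + integral {c..d} (\<lambda>x. g2 (q x) * f' x) - integral {c..d} (\<lambda>x. g3 (q x) * f' x)"
    using I cont_g by (simp add: Henstock_Kurzweil_Integration.integral_diff
        Henstock_Kurzweil_Integration.integral_add integrable_add)
  then show ?thesis
    using B[of g1] B[of g2] B[of g3] mono_g bound by force
qed

text \<open>A first-derivative test without a lower bound for the derivative. Where
  \<open>\<bar>q\<bar> < 1\<close> the cosine is estimated trivially on at most \<open>n\<close>
  intervals of length \<open>2 * m\<close>. The rest is \<open>1 / M\<close> times an integral that
  costs 12 on each of at most \<open>n + 1\<close> intervals free of zeros of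
  \<open>q'\<close>.\<close>

lemma cos_integral_bound:
  fixes \<psi> q q' :: "real \<Rightarrow> real"
  assumes "a \<le> b" "M > 0" "m > 0"
    and psi: "\<And>u. u \<in> {a..b} \<Longrightarrow> (\<psi> has_real_derivative M * q u) (at u)"
    and q: "\<And>u. u \<in> {a..b} \<Longrightarrow> (q has_real_derivative q' u) (at u)"
    and q'_cont: "continuous_on {a..b} q'"
    and Z: "finite Z" "card Z \<le> n" "\<And>u. u \<in> {a<..<b} \<Longrightarrow> q' u = 0 \<Longrightarrow> u \<in> Z"
    and sep: "\<And>T. finite T \<Longrightarrow> T \<subseteq> {u \<in> {a..b}. \<bar>q u\<bar> < 1} \<Longrightarrow>
       (\<And>s t. s \<in> T \<Longrightarrow> t \<in> T \<Longrightarrow> s \<noteq> t \<Longrightarrow> m \<le> \<bar>s - t\<bar>) \<Longrightarrow> card T \<le> n"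
  shows "\<bar>integral {a..b} (\<lambda>u. cos (\<psi> u))\<bar> \<le> 2 * m * n + 12 * (real n + 1) / M"
proof -
  have cont: "continuous_on {a..b} \<psi>" "continuous_on {a..b} q"
    by (rule DERIV_continuous_on, erule psi[THEN has_field_derivative_at_within],
        rule DERIV_continuous_on, erule q[THEN has_field_derivative_at_within])
  have cq: "continuous_on {a..b} (\<lambda>u. clamp_inv (q u))"
    using cont continuous_on_clamp_inv by (auto intro: continuous_on_compose2)
  \<comment> \<open>The cosine equals \<open>h + w / M\<close>. As \<open>M * q\<close> is the
    derivative of \<open>\<psi>\<close>, \<open>w\<close> is \<open>clamp_inv (q u)\<close> times
    the derivative of \<open>sin (\<psi> u)\<close>, while \<open>h\<close> vanishes where
    \<open>1 \<le> \<bar>q u\<bar>\<close>.\<close>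
  define h where "h u = cos (\<psi> u) * (1 - q u * clamp_inv (q u))" for u
  define w where "w u = clamp_inv (q u) * (cos (\<psi> u) * (M * q u))" for u
  have hi: "h integrable_on {a..b}" and wi: "w integrable_on {a..b}"
    unfolding h_def w_def using cont cq by (auto intro!: integrable_continuous_real continuous_intros)
  obtain T where T: "finite T" "card T \<le> n" "{u \<in> {a..b}. \<bar>q u\<bar> < 1} \<subseteq> (\<Union>t\<in>T. {t - m..t + m})"
    using separated_cover[OF \<open>m > 0\<close> sep] by blast
  have "\<bar>integral {a..b} h\<bar> \<le> 2 * m * n"
  proof (rule integral_bound_on_cover[OF hi T(1,2) \<open>m > 0\<close>])
    fix u assume u: "u \<in> {a..b}"
    show "\<bar>h u\<bar> \<le> 1"
      unfolding h_def abs_mult using clamp_inv_mult[of "q u"] by (intro mult_le_one) auto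
    assume "u \<notin> (\<Union>t\<in>T. {t - m..t + m})"
    then have "1 \<le> \<bar>q u\<bar>" using T(3) u by force
    then show "h u = 0" by (simp add: h_def clamp_inv_large)
  qed
  moreover have "\<bar>integral {a..b} w\<bar> \<le> 12 * (real n + 1)"
  proof -
    have "\<bar>integral {a..b} w\<bar> \<le> (real (card (Z \<inter> {a<..<b})) + 1) * 12"
    proof (rule integral_bound_by_breakpoints[OF Z(1) \<open>a \<le> b\<close> wi])
      fix c d assume cd: "a \<le> c" "c \<le> d" "d \<le> b" "Z \<inter> {c<..<d} = {}"
      then have sub: "{c..d} \<subseteq> {a..b}" by auto
      have mono: "mono_on {c..d} q \<or> antimono_on {c..d} q"
      proof (rule mono_on_or_antimono_on_if_deriv_nonzero)
        show "q' x \<noteq> 0" if "x \<in> {c<..<d}" for x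
          using that cd Z(3)[of x] by auto
      qed (use q sub q'_cont in \<open>auto intro: continuous_on_subset\<close>)
      show "\<bar>integral {c..d} w\<bar> \<le> 12"
        unfolding w_def
      proof (rule integral_clamp_inv_bound[OF \<open>c \<le> d\<close> _ _ _ _ mono, where f = "\<lambda>u. sin (\<psi> u)"])
        fix x assume "x \<in> {c..d}"
        then have "(\<psi> has_real_derivative M * q x) (at x)" using psi sub by blast
        then show "((\<lambda>u. sin (\<psi> u)) has_real_derivative cos (\<psi> x) * (M * q x)) (at x)"
          by (auto intro!: derivative_eq_intros)
      qed (use cont sub in \<open>auto intro!: continuous_intros intro: continuous_on_subset\<close>)
    qed
    also have "\<dots> \<le> (real n + 1) * 12"
      using Z card_mono[of Z "Z \<inter> {a<..<b}"] by auto
    finally show ?thesis by (simp add: mult.commute)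
  qed
  moreover have "integral {a..b} (\<lambda>u. cos (\<psi> u)) = integral {a..b} h + integral {a..b} w / M"
  proof -
    have "(\<lambda>u. cos (\<psi> u)) = (\<lambda>u. h u + w u / M)"
      using \<open>M > 0\<close> by (auto simp: h_def w_def field_simps)
    then show ?thesis
      using hi wi by (simp add: Henstock_Kurzweil_Integration.integral_add integrable_on_divide)
  qed
  moreover have "\<bar>integral {a..b} w / M\<bar> \<le> 12 * (real n + 1) / M"
    using calculation(2) \<open>M > 0\<close> by (simp add: abs_divide divide_right_mono)
  ultimately show ?thesis by linarith
qed

section \<open>Coefficient bounds from Lagrange interpolation\<close>

text \<open>Multiplication by a linear factor with root \<open>a\<close> adds a shifted copy of the
  coefficients to a copy scaled by \<open>- a\<close>, so the sum of absolute values grows by a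
  factor of at most \<open>1 + \<bar>a\<bar>\<close>.\<close>

lemma sum_abs_coeff_prod_linear_le:
  fixes A :: "real set"
  assumes "finite A"
  shows "(\<Sum>j\<le>n. \<bar>coeff (\<Prod>a\<in>A. [:- a, 1:]) j\<bar>) \<le> (\<Prod>a\<in>A. 1 + \<bar>a\<bar>)"
  using assms
proof (induction A arbitrary: n rule: finite_induct)
  case empty
  show ?case by (induction n) (auto simp: coeff_1 sum.delta)
next
  case (insert a A)
  define p where "p = (\<Prod>a\<in>A. [:- a, 1:])"
  let ?N = "(\<Prod>a\<in>A. 1 + \<bar>a\<bar>)"
  have IH: "(\<Sum>j\<le>n. \<bar>coeff p j\<bar>) \<le> ?N" for n
    using insert.IH by (simp add: p_def)
  have "(\<Sum>j\<le>n. \<bar>coeff ([:- a, 1:] * p) j\<bar>) \<le> \<bar>a\<bar> * ?N + ?N"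
  proof -
    have "(\<Sum>j\<le>n. \<bar>coeff ([:- a, 1:] * p) j\<bar>)
        \<le> (\<Sum>j\<le>n. \<bar>a\<bar> * \<bar>coeff p j\<bar> + \<bar>coeff (pCons 0 p) j\<bar>)"
      by (intro sum_mono) (simp add: abs_mult flip: abs_mult)
    also have "\<dots> = \<bar>a\<bar> * (\<Sum>j\<le>n. \<bar>coeff p j\<bar>) + (\<Sum>j\<le>n. \<bar>coeff (pCons 0 p) j\<bar>)"
      by (simp add: sum.distrib sum_distrib_left)
    \<comment> \<open>The shift turns a partial sum up to \<open>n\<close> into one up to
      \<open>n - 1\<close>, which is why the induction keeps \<open>n\<close> arbitrary.\<close>
    also have "(\<Sum>j\<le>n. \<bar>coeff (pCons 0 p) j\<bar>) \<le> ?N"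
    proof (cases n)
      case 0
      then show ?thesis by (auto intro!: prod_nonneg)
    next
      case (Suc n')
      show ?thesis using IH[of n'] unfolding Suc sum.atMost_Suc_shift by simp
    qed
    also have "\<bar>a\<bar> * (\<Sum>j\<le>n. \<bar>coeff p j\<bar>) \<le> \<bar>a\<bar> * ?N"
      using IH by (intro mult_left_mono) auto
    finally show ?thesis by simp
  qed
  then show ?case
    using insert.hyps by (simp add: p_def algebra_simps)
qed

text \<open>Lagrange interpolation at the nodes \<open>T\<close> recovers \<open>p\<close> from its
  values. The numerator of each basis polynomial has \<open>k\<close> linear factors with roots in
  [0, 1], and each factor contributes at most 2.\<close>

lemma sum_abs_coeff_le_lagrange:
  fixes p :: "real poly"
  assumes "finite T" "card T = Suc k" "degree p \<le> k" "T \<subseteq> {0..1}"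
  shows "(\<Sum>j\<le>n. \<bar>coeff p j\<bar>) \<le> 2 ^ k * (\<Sum>s\<in>T. \<bar>poly p s\<bar> / (\<Prod>t\<in>T - {s}. \<bar>s - t\<bar>))"
proof -
  define w where "w s = poly p s / (\<Prod>t\<in>T - {s}. s - t)" for s
  define l where "l s = (\<Prod>t\<in>T - {s}. [:- t, 1:])" for s
  have card: "card (T - {s}) = k" if "s \<in> T" for s
    using assms that by simp
  \<comment> \<open>Both sides have degree less than \<open>card T\<close> and agree on
    \<open>T\<close>.\<close>
  have "p = (\<Sum>s\<in>T. smult (w s) (l s))"
  proof (rule poly_eqI_degree[of T])
    fix x assume "x \<in> T"
    have "poly (l s) x = (if s = x then (\<Prod>t\<in>T - {x}. x - t) else 0)" if "s \<in> T" for s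
      using \<open>finite T\<close> \<open>x \<in> T\<close> by (auto simp: l_def poly_prod)
    then have "poly (\<Sum>s\<in>T. smult (w s) (l s)) x = (\<Sum>s\<in>T. if s = x then poly p x else 0)"
      unfolding poly_sum using \<open>finite T\<close> by (intro sum.cong) (auto simp: w_def)
    then show "poly p x = poly (\<Sum>s\<in>T. smult (w s) (l s)) x"
      using \<open>finite T\<close> \<open>x \<in> T\<close> by simp
  next
    have "degree (smult (w s) (l s)) \<le> k" if "s \<in> T" for s
    proof -
      have "degree (l s) \<le> (\<Sum>t\<in>T - {s}. degree [:- t, 1:])"
        unfolding l_def using degree_prod_sum_le[of "T - {s}" "\<lambda>t. [:- t, 1:]"] \<open>finite T\<close>
        by (simp add: o_def)
      then show ?thesis using card[OF that] degree_smult_le[of "w s" "l s"] by simp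
    qed
    then show "degree (\<Sum>s\<in>T. smult (w s) (l s)) < card T"
      using assms(2) degree_sum_le[OF \<open>finite T\<close>, of "\<lambda>s. smult (w s) (l s)" k] by simp
  qed (use assms in auto)
  then have "(\<Sum>j\<le>n. \<bar>coeff p j\<bar>) = (\<Sum>j\<le>n. \<bar>\<Sum>s\<in>T. w s * coeff (l s) j\<bar>)"
    by (metis (no_types, lifting) coeff_smult coeff_sum sum.cong)
  also have "\<dots> \<le> (\<Sum>j\<le>n. \<Sum>s\<in>T. \<bar>w s\<bar> * \<bar>coeff (l s) j\<bar>)"
    by (intro sum_mono order_trans[OF sum_abs]) (simp add: abs_mult)
  also have "\<dots> = (\<Sum>s\<in>T. \<bar>w s\<bar> * (\<Sum>j\<le>n. \<bar>coeff (l s) j\<bar>))"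
    by (subst sum.swap) (simp add: sum_distrib_left)
  also have "\<dots> \<le> (\<Sum>s\<in>T. \<bar>w s\<bar> * 2 ^ k)"
  proof (intro sum_mono mult_left_mono)
    fix s assume "s \<in> T"
    have "(\<Sum>j\<le>n. \<bar>coeff (l s) j\<bar>) \<le> (\<Prod>t\<in>T - {s}. 1 + \<bar>t\<bar>)"
      unfolding l_def using \<open>finite T\<close> by (intro sum_abs_coeff_prod_linear_le) auto
    also have "\<dots> \<le> (\<Prod>t\<in>T - {s}. 2)"
      using assms(4) by (intro prod_mono) auto
    finally show "(\<Sum>j\<le>n. \<bar>coeff (l s) j\<bar>) \<le> 2 ^ k"
      using card[OF \<open>s \<in> T\<close>] by simp
  qed auto
  also have "\<dots> = 2 ^ k * (\<Sum>s\<in>T. \<bar>poly p s\<bar> / (\<Prod>t\<in>T - {s}. \<bar>s - t\<bar>))"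
    by (simp add: w_def sum_distrib_left abs_divide abs_prod mult.commute)
  finally show ?thesis .
qed

section \<open>Sublevel sets of a polynomial in a real power\<close>

text \<open>For \<open>t \<le> s\<close>, replace one factor \<open>t powr (\<gamma> - 1)\<close> by
  the larger \<open>s powr (\<gamma> - 1)\<close>. The factor at \<open>s\<close> survives whichever
  point is larger, so a single factor serves all differences from one interpolation node.\<close>

lemma powr_diff_ge:
  fixes s t \<gamma> :: real
  assumes "0 < s" "0 < t" "1 \<le> \<gamma>"
  shows "s powr (\<gamma> - 1) * \<bar>s - t\<bar> \<le> \<bar>s powr \<gamma> - t powr \<gamma>\<bar>"
proof -
  have aux: "s powr (\<gamma> - 1) * (s - t) \<le> s powr \<gamma> - t powr \<gamma>" if "0 < t" "t \<le> s" for s t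
  proof -
    have "t powr \<gamma> = t * t powr (\<gamma> - 1)" "s powr \<gamma> = s * s powr (\<gamma> - 1)"
      using that by (auto simp: powr_diff)
    moreover have "t * t powr (\<gamma> - 1) \<le> t * s powr (\<gamma> - 1)"
      using that assms by (intro mult_left_mono powr_mono2) auto
    ultimately show ?thesis by (simp add: algebra_simps)
  qed
  show ?thesis
  proof (cases "t \<le> s")
    case True
    then show ?thesis using aux[of t s] assms by auto
  next
    case False
    have "s powr (\<gamma> - 1) * (t - s) \<le> t powr (\<gamma> - 1) * (t - s)"
      using False assms by (intro mult_right_mono powr_mono2) auto
    also have "\<dots> \<le> t powr \<gamma> - s powr \<gamma>"
      using aux[of s t] False assms by simp
    finally show ?thesis using False by simp
  qed
qed

lemma inj_on_powr_positive:
  fixes a :: real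
  assumes "a \<noteq> 0"
  shows "inj_on (\<lambda>u::real. u powr a) {0<..}"
  using assms by (intro inj_on_inverseI[where g = "\<lambda>v. v powr (1 / a)"]) (simp add: powr_powr)

text \<open>Given \<open>k + 1\<close> such points, interpolate \<open>p\<close> at their images
  under \<open>u powr (1 / \<beta>)\<close>. Small values and large gaps force the coefficient sum
  below what the normalisation of \<open>y\<close> prescribes.\<close>

lemma card_separated_sublevel_le:
  fixes p :: "real poly" and \<beta> y :: real
  assumes k: "1 \<le> k" and deg: "degree p \<le> k"
    and \<beta>: "0 < \<beta>" "\<beta> \<le> 1" "real k \<le> \<beta> * (real k + 1)"
    and y: "0 < y" "y ^ (k + 1) * (\<Sum>j\<le>k. \<bar>coeff p j\<bar>) = 1"
    and T: "finite T" "T \<subseteq> {0<..1}" "\<And>u. u \<in> T \<Longrightarrow> \<bar>poly p (u powr (1 / \<beta>))\<bar> \<le> u / y"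
    and sep: "\<And>s t. s \<in> T \<Longrightarrow> t \<in> T \<Longrightarrow> s \<noteq> t \<Longrightarrow> 3 * (real k + 1) * y \<le> \<bar>s - t\<bar>"
  shows "card T \<le> k"
proof (rule ccontr)
  assume "\<not> card T \<le> k"
  then obtain U where U: "U \<subseteq> T" "card U = Suc k"
    by (meson not_less_eq_eq obtain_subset_with_card_n)
  then have "finite U" using T finite_subset by blast
  define g where "g u = u powr (1 / \<beta>)" for u :: real
  define m where "m = 3 * (real k + 1) * y"
  let ?L = "\<Sum>j\<le>k. \<bar>coeff p j\<bar>"
  have "0 < m" using y by (simp add: m_def)
  have inj: "inj_on g U"
    unfolding g_def using U T \<beta> by (intro inj_on_subset[OF inj_on_powr_positive]) auto
  have g01: "g ` U \<subseteq> {0..1}"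
    unfolding g_def using U T \<beta> by (auto intro!: powr_le1 simp: subset_iff less_imp_le)
  have pt: "\<bar>poly p (g s)\<bar> / (\<Prod>t\<in>U - {s}. \<bar>g s - g t\<bar>) \<le> 1 / (y * m ^ k)" if "s \<in> U" for s
  proof -
    have s: "0 < s" "s \<le> 1" using that U T by auto
    \<comment> \<open>Up to the factor \<open>1 / \<beta>\<close>, \<open>r\<close> is the
      derivative of \<open>g\<close> at \<open>s\<close>. A gap \<open>m\<close> between points
      therefore becomes a gap of at least \<open>r * m\<close> between \<open>g s\<close> and the
      other nodes.\<close>
    define r where "r = s powr (1 / \<beta> - 1)"
    have "0 < r" using s by (simp add: r_def)
    have "(r * m) ^ k = (\<Prod>t\<in>U - {s}. r * m)"
      using U \<open>finite U\<close> that by simp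
    also have "\<dots> \<le> (\<Prod>t\<in>U - {s}. \<bar>g s - g t\<bar>)"
    proof (intro prod_mono conjI)
      fix t assume t: "t \<in> U - {s}"
      have "r * m \<le> r * \<bar>s - t\<bar>"
        using sep[of s t] t that U s by (intro mult_left_mono) (auto simp: m_def r_def)
      also have "\<dots> \<le> \<bar>g s - g t\<bar>"
        unfolding r_def g_def using s t U T \<beta> by (intro powr_diff_ge) auto
      finally show "r * m \<le> \<bar>g s - g t\<bar>" .
    qed (use \<open>0 < m\<close> in \<open>auto simp: r_def\<close>)
    finally have prod: "(r * m) ^ k \<le> (\<Prod>t\<in>U - {s}. \<bar>g s - g t\<bar>)" .
    \<comment> \<open>Since \<open>s \<le> 1\<close>, it suffices that the exponent
      \<open>(1 / \<beta> - 1) * real k\<close> is at most 1, which is the hypothesis relating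
      \<open>k\<close> and \<open>\<beta>\<close>. The factor \<open>s\<close> in the bound for the
      value at \<open>g s\<close> is thus absorbed by the \<open>k\<close> factors \<open>r\<close>
      in the denominator, even for \<open>s\<close> near 0.\<close>
    have "s \<le> r ^ k"
    proof -
      have "s powr 1 \<le> s powr ((1 / \<beta> - 1) * real k)"
        using s \<beta> by (intro powr_mono') (auto simp: field_simps)
      then show ?thesis using s by (simp add: r_def powr_power mult.commute)
    qed
    have "\<bar>poly p (g s)\<bar> / (\<Prod>t\<in>U - {s}. \<bar>g s - g t\<bar>) \<le> (r ^ k / y) / (r * m) ^ k"
    proof (rule frac_le)
      have "\<bar>poly p (g s)\<bar> \<le> s / y" using T(3)[of s] that U by (auto simp: g_def)
      also have "\<dots> \<le> r ^ k / y" using \<open>s \<le> r ^ k\<close> y by (intro divide_right_mono) auto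
      finally show "\<bar>poly p (g s)\<bar> \<le> r ^ k / y" .
    qed (use prod \<open>0 < m\<close> \<open>0 < r\<close> y in auto)
    also have "\<dots> = 1 / (y * m ^ k)"
      using \<open>0 < r\<close> by (simp add: power_mult_distrib)
    finally show ?thesis .
  qed
  have "?L \<le> 2 ^ k * (\<Sum>x\<in>g ` U. \<bar>poly p x\<bar> / (\<Prod>z\<in>g ` U - {x}. \<bar>x - z\<bar>))"
    using \<open>finite U\<close> U inj g01 deg by (intro sum_abs_coeff_le_lagrange) (auto simp: card_image)
  also have "(\<Sum>x\<in>g ` U. \<bar>poly p x\<bar> / (\<Prod>z\<in>g ` U - {x}. \<bar>x - z\<bar>))
      = (\<Sum>s\<in>U. \<bar>poly p (g s)\<bar> / (\<Prod>t\<in>U - {s}. \<bar>g s - g t\<bar>))"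
  proof (subst sum.reindex[OF inj], intro sum.cong refl)
    fix s assume "s \<in> U"
    have "g ` U - {g s} = g ` (U - {s})"
      using inj \<open>s \<in> U\<close> by (auto simp: inj_on_def)
    moreover have "inj_on g (U - {s})" using inj by (rule inj_on_subset) auto
    ultimately show "((\<lambda>x. \<bar>poly p x\<bar> / (\<Prod>z\<in>g ` U - {x}. \<bar>x - z\<bar>)) \<circ> g) s
        = \<bar>poly p (g s)\<bar> / (\<Prod>t\<in>U - {s}. \<bar>g s - g t\<bar>)"
      by (simp add: prod.reindex)
  qed
  also have "\<dots> \<le> (real k + 1) * (1 / (y * m ^ k))"
    using sum_bounded_above[OF pt, of U "\<lambda>x. x"] U by (simp add: add.commute)
  finally have "?L \<le> 2 ^ k * ((real k + 1) * (1 / (y * m ^ k)))" by simp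
  then have "?L * y * m ^ k \<le> 2 ^ k * (real k + 1)"
    using y \<open>0 < m\<close> by (simp add: field_simps)
  moreover have "?L * y * m ^ k = 3 ^ k * (real k + 1) ^ k"
  proof -
    have "?L * y * m ^ k = (y ^ (k + 1) * ?L) * (3 ^ k * (real k + 1) ^ k)"
      by (simp only: m_def power_mult_distrib power_add power_one_right mult_ac)
    then show ?thesis by (simp only: y(2) mult_1)
  qed
  \<comment> \<open>The constant \<open>3 * (real k + 1)\<close> in the separation is chosen for
    this: 3 beats the 2 from the interpolation bound, and a power of \<open>real k + 1\<close>
    absorbs the number of nodes.\<close>
  moreover have "(2::real) ^ k * (real k + 1) < 3 ^ k * (real k + 1) ^ k"
  proof (rule mult_less_le_imp_less)
    show "(2::real) ^ k < 3 ^ k" using k by (intro power_strict_mono) auto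
    show "real k + 1 \<le> (real k + 1) ^ k" using k by (intro self_le_power) auto
  qed auto
  ultimately show False by linarith
qed

section \<open>The truncated phase integral\<close>

lemma coeff_sum_monom: "coeff (\<Sum>i\<le>k. monom (c i) i) j = (if j \<le> k then c j else 0)"
  by (simp add: coeff_sum)

lemma degree_sum_monom_le: "degree (\<Sum>i\<le>k. monom (c i) i) \<le> k"
  by (intro degree_le) (simp add: coeff_sum_monom)

lemma powr_inverse_power:
  "(u powr (1 / \<beta>)) ^ j = u powr (real j / \<beta>)" if "0 < u" for u :: real
  using that by (simp add: powr_power)

text \<open>\<open>cos_integral_bound\<close> applies with \<open>n = k\<close>: the interpolation
  argument limits the separated points where \<open>\<bar>q\<bar> < 1\<close>, and a root count
  limits the zeros of \<open>q'\<close>. The two terms are at most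
  \<open>6 * k * (k + 1) * y\<close> and \<open>2 * (k + 1) * y\<close>.\<close>

lemma cos_phase_integral_bound:
  fixes c :: "nat \<Rightarrow> real" and \<beta> y :: real
  assumes k: "2 \<le> k" and ck: "c k \<noteq> 0"
    and \<beta>: "0 < \<beta>" "\<beta> \<le> 1" "real k \<le> \<beta> * (real k + 1)"
    and y: "0 < y" "y ^ (k + 1) * (\<Sum>j\<le>k. \<bar>c j\<bar>) = 1"
    and psi: "\<And>u. 0 < u \<Longrightarrow> (\<psi> has_real_derivative
           2 * pi / \<beta> * (\<Sum>j\<le>k. c j * u powr (real j / \<beta> - 1))) (at u)"
    and \<epsilon>: "0 < \<epsilon>" "\<epsilon> \<le> 1"
  shows "\<bar>integral {\<epsilon>..1} (\<lambda>u. cos (\<psi> u))\<bar> \<le> (real k + 1) * (6 * real k + 2) * y"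
proof -
  define p where "p = (\<Sum>j\<le>k. monom (c j) j)"
  define r where "r = (\<Sum>j\<le>k. monom (c j * (real j / \<beta> - 1)) j)"
  define q where "q u = y * (\<Sum>j\<le>k. c j * u powr (real j / \<beta> - 1))" for u
  define q' where "q' u = y * (\<Sum>j\<le>k. c j * ((real j / \<beta> - 1) * u powr (real j / \<beta> - 2)))" for u
  \<comment> \<open>Up to a positive factor, \<open>q' u\<close> is \<open>r\<close> evaluated at
    \<open>u powr (1 / \<beta>)\<close>; raising its roots to the power \<open>\<beta>\<close>
    returns to the variable \<open>u\<close>.\<close>
  define Z where "Z = (\<lambda>t. t powr \<beta>) ` {t. poly r t = 0}"
  define m where "m = 3 * (real k + 1) * y"
  \<comment> \<open>The factor \<open>y\<close> in \<open>q\<close> normalises the threshold to 1,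
    and \<open>M\<close> compensates so that \<open>M * q\<close> is the derivative of
    \<open>\<psi>\<close>.\<close>
  define M where "M = 2 * pi / (\<beta> * y)"
  have q_eq: "q u = y * poly p (u powr (1 / \<beta>)) / u" if "0 < u" for u
    using that by (simp add: q_def p_def poly_sum poly_monom powr_inverse_power powr_diff
        sum_divide_distrib flip: times_divide_eq_right)
  have q'_eq: "q' u = y * poly r (u powr (1 / \<beta>)) / u\<^sup>2" if "0 < u" for u
    using that by (simp add: q'_def r_def poly_sum poly_monom powr_inverse_power powr_diff
        sum_divide_distrib sum_distrib_left algebra_simps diff_divide_distrib)
  \<comment> \<open>The factor \<open>real k / \<beta> - 1\<close> is at least \<open>k - 1\<close>,
    hence positive.\<close>
  have "coeff r k \<noteq> 0"
    using ck k \<beta> by (simp add: r_def coeff_sum_monom)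
  then have "r \<noteq> 0" by auto
  then have finZ: "finite {t. poly r t = 0}" by (rule poly_roots_finite)
  have "degree r \<le> k" unfolding r_def by (rule degree_sum_monom_le)
  then have "card Z \<le> k"
    using card_image_le[OF finZ, of "\<lambda>t. t powr \<beta>"] card_poly_roots_bound[OF \<open>r \<noteq> 0\<close>]
    by (simp add: Z_def)
  have "\<bar>integral {\<epsilon>..1} (\<lambda>u. cos (\<psi> u))\<bar> \<le> 2 * m * k + 12 * (real k + 1) / M"
  proof (rule cos_integral_bound[where q = q and q' = q' and Z = Z])
    show "0 < m" "0 < M" using y \<beta> by (auto simp: m_def M_def)
    show "finite Z" using finZ by (simp add: Z_def)
    show "continuous_on {\<epsilon>..1} q'"
      unfolding q'_def[abs_def] using \<epsilon> by (intro continuous_intros) auto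
    fix u assume u: "u \<in> {\<epsilon>..1}"
    then have "0 < u" using \<epsilon> by simp
    show "(\<psi> has_real_derivative M * q u) (at u)"
      using psi[OF \<open>0 < u\<close>] y by (simp add: M_def q_def mult.assoc)
    have "((\<lambda>u. \<Sum>j\<le>k. c j * u powr (real j / \<beta> - 1)) has_real_derivative
        (\<Sum>j\<le>k. c j * ((real j / \<beta> - 1) * u powr (real j / \<beta> - 1 - 1)))) (at u)"
      using \<open>0 < u\<close> by (intro DERIV_sum DERIV_cmult has_real_derivative_powr)
    from DERIV_cmult[OF this, of y] show "(q has_real_derivative q' u) (at u)"
      by (simp add: q_def[abs_def] q'_def)
  next
    fix u assume u: "u \<in> {\<epsilon><..<1}" "q' u = 0"
    then have "poly r (u powr (1 / \<beta>)) = 0" "u = (u powr (1 / \<beta>)) powr \<beta>"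
      using q'_eq[of u] \<epsilon> y \<beta> by (auto simp: powr_powr)
    then show "u \<in> Z" unfolding Z_def by blast
  next
    fix T assume T: "finite T" "T \<subseteq> {u \<in> {\<epsilon>..1}. \<bar>q u\<bar> < 1}"
      "\<And>s t. s \<in> T \<Longrightarrow> t \<in> T \<Longrightarrow> s \<noteq> t \<Longrightarrow> m \<le> \<bar>s - t\<bar>"
    show "card T \<le> k"
    proof (rule card_separated_sublevel_le[where p = p])
      show "degree p \<le> k" unfolding p_def by (rule degree_sum_monom_le)
      show "y ^ (k + 1) * (\<Sum>j\<le>k. \<bar>coeff p j\<bar>) = 1"
        using y by (simp add: p_def coeff_sum_monom)
      show "\<bar>poly p (u powr (1 / \<beta>))\<bar> \<le> u / y" if "u \<in> T" for u
      proof -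
        have "0 < u" "\<bar>q u\<bar> < 1" using that T \<epsilon> by auto
        then show ?thesis using y by (simp add: q_eq abs_mult field_simps)
      qed
      show "T \<subseteq> {0<..1}" using T \<epsilon> by auto
    qed (use k \<beta> y T in \<open>auto simp: m_def\<close>)
  qed (use \<epsilon> \<open>card Z \<le> k\<close> in auto)
  also have "12 * (real k + 1) / M \<le> 2 * (real k + 1) * y"
  proof -
    have "12 * (real k + 1) / M = \<beta> * y * (12 * (real k + 1)) / (2 * pi)"
      using y \<beta> by (simp add: M_def)
    also have "\<dots> \<le> 1 * y * (12 * (real k + 1)) / (2 * 3)"
      using y \<beta> pi_gt3 by (intro frac_le mult_mono mult_nonneg_nonneg) auto
    also have "\<dots> = 2 * (real k + 1) * y" by (simp add: field_simps)
    finally show ?thesis .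
  qed
  finally show ?thesis by (simp add: m_def algebra_simps)
qed

section \<open>The singular endpoint and the change of variables\<close>

text \<open>The omitted piece has absolute value at most \<open>\<epsilon>\<close>, which can be
  made arbitrarily small. This permits estimates that use derivatives only away from 0.\<close>

lemma abs_integral_01_le_if_truncations_le:
  fixes f :: "real \<Rightarrow> real"
  assumes f: "f integrable_on {0..1}" and f1: "\<And>x. \<bar>f x\<bar> \<le> 1"
    and K: "\<And>\<epsilon>. 0 < \<epsilon> \<Longrightarrow> \<epsilon> \<le> 1 \<Longrightarrow> \<bar>integral {\<epsilon>..1} f\<bar> \<le> K"
  shows "\<bar>integral {0..1} f\<bar> \<le> K"
proof (rule field_le_epsilon)
  fix e :: real assume "0 < e"
  define \<epsilon> where "\<epsilon> = min e 1"
  have \<epsilon>: "0 < \<epsilon>" "\<epsilon> \<le> 1" "\<epsilon> \<le> e" using \<open>0 < e\<close> by (auto simp: \<epsilon>_def)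
  have "f integrable_on {0..\<epsilon>}"
    using f \<epsilon> by (auto intro: integrable_on_subinterval)
  then have "norm (integral {0..\<epsilon>} f) \<le> integral {0..\<epsilon>} (\<lambda>_. 1)"
    using f1 by (intro integral_norm_bound_integral) auto
  moreover have "integral {0..\<epsilon>} f + integral {\<epsilon>..1} f = integral {0..1} f"
    using f \<epsilon> by (intro Henstock_Kurzweil_Integration.integral_combine) auto
  ultimately show "\<bar>integral {0..1} f\<bar> \<le> K + e"
    using K[OF \<epsilon>(1,2)] \<epsilon> by simp
qed

text \<open>Meant for phases containing \<open>ln u\<close>, for which the integrand need not extend
  continuously to 0.\<close>

lemma bounded_continuous_absolutely_integrable:
  fixes f :: "real \<Rightarrow> 'a::euclidean_space"
  assumes "continuous_on {0<..<1} f" "\<And>x. x \<in> {0<..<1} \<Longrightarrow> norm (f x) \<le> B"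
  shows "f absolutely_integrable_on {0<..<1}"
proof (rule measurable_bounded_by_integrable_imp_absolutely_integrable[where g = "\<lambda>_. B"])
  show "f \<in> borel_measurable (lebesgue_on {0<..<1})"
    using assms(1) by (intro continuous_imp_measurable_on_sets_lebesgue) auto
  show "(\<lambda>_. B) integrable_on {0<..<1::real}"
    by (rule integrable_on_const) (rule lmeasurable_interval)
qed (use assms in auto)

text \<open>Under \<open>x = X * u powr (1 / \<beta>)\<close> the Jacobian cancels the amplitude
  \<open>x powr (\<beta> - 1)\<close> up to the constant \<open>X powr \<beta> / \<beta>\<close>.
  The imaginary part of the exponent becomes the term \<open>\<tau> * ln x\<close> of the
  phase.\<close>

lemma osc_integral_substitution:
  fixes \<theta> :: "nat \<Rightarrow> real" and \<tau> \<beta> X :: real and k :: nat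
  defines "\<psi> \<equiv> \<lambda>u. 2 * pi * ((\<Sum>j=1..k. \<theta> j * X ^ j * u powr (real j / \<beta>)) + \<tau> * (ln X + ln u / \<beta>))"
  assumes "0 < X" "0 < \<beta>"
  shows "osc_integral k X \<theta> (of_real \<beta> + 2 * of_real pi * \<i> * of_real \<tau>)
    = of_real (X powr \<beta> / \<beta>) * integral {0<..<1} (\<lambda>u. cis (\<psi> u))"
    and "(\<lambda>u. cis (\<psi> u)) absolutely_integrable_on {0<..<1}"
proof -
  define \<rho> where "\<rho> = complex_of_real \<beta> + 2 * of_real pi * \<i> * of_real \<tau>"
  define f where "f x = unit_exp (\<Sum>j=1..k. \<theta> j * x ^ j) * complex_of_real x powr (\<rho> - 1)" for x
  define g where "g u = X * u powr (1 / \<beta>)" for u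
  define h where "h u = X * ((1 / \<beta>) * u powr (1 / \<beta> - 1))" for u
  have cont: "continuous_on {0<..<1} (\<lambda>u. cis (\<psi> u))"
    unfolding \<psi>_def using \<open>0 < \<beta>\<close>
    by (intro continuous_on_cis continuous_on_mult continuous_on_add continuous_on_sum continuous_on_const
        continuous_on_divide continuous_on_ln continuous_on_powr continuous_on_id) auto
  show abs_int: "(\<lambda>u. cis (\<psi> u)) absolutely_integrable_on {0<..<1}"
    by (rule bounded_continuous_absolutely_integrable[OF cont, of 1]) simp
  have pull: "\<bar>h u\<bar> *\<^sub>R f (g u) = of_real (X powr \<beta> / \<beta>) * cis (\<psi> u)" if "u \<in> {0<..<1}" for u
  proof -
    have "0 < u" using that by simp
    have "0 < g u" using assms \<open>0 < u\<close> by (simp add: g_def)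
    have ln_g: "ln (g u) = ln X + ln u / \<beta>"
      using assms \<open>0 < u\<close> by (simp add: g_def ln_mult ln_powr)
    have "X * u powr (1 / \<beta> - 1) * g u powr (\<beta> - 1) = X powr \<beta>"
    proof -
      have "X * u powr (1 / \<beta> - 1) * g u powr (\<beta> - 1)
          = exp (ln X + (1 / \<beta> - 1) * ln u + (\<beta> - 1) * ln (g u))"
        using assms \<open>0 < u\<close> \<open>0 < g u\<close> by (simp add: powr_def exp_add)
      also have "ln X + (1 / \<beta> - 1) * ln u + (\<beta> - 1) * ln (g u) = \<beta> * ln X"
        unfolding ln_g using assms by (simp add: field_simps)
      finally show ?thesis using assms by (simp add: powr_def)
    qed
    then have amp: "\<bar>h u\<bar> * g u powr (\<beta> - 1) = X powr \<beta> / \<beta>"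
      using assms by (simp add: h_def field_simps)
    have "complex_of_real (g u) powr (\<rho> - 1)
        = of_real (g u powr (\<beta> - 1)) * cis (2 * pi * \<tau> * ln (g u))"
    proof -
      have "complex_of_real (g u) powr (\<rho> - 1) = exp ((\<rho> - 1) * of_real (ln (g u)))"
        using \<open>0 < g u\<close> by (simp add: powr_def Ln_of_real)
      also have "(\<rho> - 1) * of_real (ln (g u))
          = of_real ((\<beta> - 1) * ln (g u)) + \<i> * of_real (2 * pi * \<tau> * ln (g u))"
        by (simp add: \<rho>_def algebra_simps)
      also have "exp \<dots> = of_real (exp ((\<beta> - 1) * ln (g u))) * cis (2 * pi * \<tau> * ln (g u))"
        by (simp only: exp_add exp_of_real cis_conv_exp)
      finally show ?thesis using \<open>0 < g u\<close> by (simp add: powr_def)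
    qed
    moreover have "unit_exp v = cis (2 * pi * v)" for v
      by (simp add: unit_exp_def cis_conv_exp mult_ac)
    ultimately have "f (g u) = of_real (g u powr (\<beta> - 1))
        * (cis (2 * pi * (\<Sum>j=1..k. \<theta> j * g u ^ j)) * cis (2 * pi * \<tau> * ln (g u)))"
      by (simp add: f_def)
    also have "cis (2 * pi * (\<Sum>j=1..k. \<theta> j * g u ^ j)) * cis (2 * pi * \<tau> * ln (g u)) = cis (\<psi> u)"
      using \<open>0 < u\<close> unfolding cis_mult ln_g \<psi>_def
      by (simp add: g_def power_mult_distrib powr_inverse_power algebra_simps)
    finally have "\<bar>h u\<bar> *\<^sub>R f (g u) = of_real (\<bar>h u\<bar> * g u powr (\<beta> - 1)) * cis (\<psi> u)"
      by (simp add: scaleR_conv_of_real)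
    then show ?thesis unfolding amp .
  qed
  have img: "g ` {0<..<1} = {0<..<X}"
  proof (intro set_eqI iffI)
    fix x assume "x \<in> g ` {0<..<1}"
    then obtain u where "0 < u" "u < 1" "x = X * u powr (1 / \<beta>)" by (auto simp: g_def)
    then show "x \<in> {0<..<X}" using assms powr_less_mono2[of "1 / \<beta>" u 1] by auto
  next
    fix x assume x: "x \<in> {0<..<X}"
    then have "x = g ((x / X) powr \<beta>)"
      using assms by (simp add: g_def powr_powr)
    moreover have "(x / X) powr \<beta> < 1"
      using x assms powr_less_mono2[of \<beta> "x / X" 1] by auto
    ultimately show "x \<in> g ` {0<..<1}" using x assms by auto
  qed
  have inj: "inj_on g {0<..<1}"
    using inj_on_powr_positive[of "1 / \<beta>"] assms by (auto simp: g_def inj_on_def)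
  have deriv: "(g has_real_derivative h u) (at u within {0<..<1})" if "u \<in> {0<..<1}" for u
    unfolding g_def[abs_def] h_def using that
    by (intro has_field_derivative_at_within[OF DERIV_cmult] has_real_derivative_powr) auto
  have eq_int: "integral {0<..<1} (\<lambda>u. \<bar>h u\<bar> *\<^sub>R f (g u))
      = integral {0<..<1} (\<lambda>u. of_real (X powr \<beta> / \<beta>) * cis (\<psi> u))"
    by (intro integral_cong pull)
  have "(\<lambda>u. \<bar>h u\<bar> *\<^sub>R f (g u)) absolutely_integrable_on {0<..<1}
      \<longleftrightarrow> (\<lambda>u. of_real (X powr \<beta> / \<beta>) * cis (\<psi> u)) absolutely_integrable_on {0<..<1}"
    using pull by (intro set_integrable_cong refl) auto
  moreover have "(\<lambda>u. of_real (X powr \<beta> / \<beta>) * cis (\<psi> u)) absolutely_integrable_on {0<..<1}"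
    using abs_int by (rule set_integrable_mult_right)
  \<comment> \<open>The change of variables is an equivalence that also transfers absolute
    integrability, known here for the bounded integrand in \<open>u\<close>, back to
    \<open>f\<close>.\<close>
  ultimately have "integral (g ` {0<..<1}) f = integral {0<..<1} (\<lambda>u. \<bar>h u\<bar> *\<^sub>R f (g u))"
    using has_absolute_integral_change_of_variables_real[of "{0<..<1}" g h f, OF _ deriv inj] by auto
  then have "integral {0<..<X} f = of_real (X powr \<beta> / \<beta>) * integral {0<..<1} (\<lambda>u. cis (\<psi> u))"
    unfolding img eq_int by simp
  moreover have "integral {0<..<X} f = integral {0..X} f"
    using integral_open_interval_real[of 0 X f] by simp
  ultimately show "osc_integral k X \<theta> (of_real \<beta> + 2 * of_real pi * \<i> * of_real \<tau>)
    = of_real (X powr \<beta> / \<beta>) * integral {0<..<1} (\<lambda>u. cis (\<psi> u))"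
    unfolding osc_integral_def f_def[abs_def] \<rho>_def by simp
qed

text \<open>Rotating the integral by its own argument makes it real and nonnegative, so its modulus
  is the integral of a shifted cosine. The bound must be uniform in the shift \<open>\<phi>\<close>
  because the argument is not known.\<close>

lemma norm_integral_cis_le:
  fixes \<psi> :: "real \<Rightarrow> real"
  assumes int: "(\<lambda>u. cis (\<psi> u)) integrable_on {0<..<1}"
    and K: "\<And>\<phi> \<epsilon>. 0 < \<epsilon> \<Longrightarrow> \<epsilon> \<le> 1 \<Longrightarrow> \<bar>integral {\<epsilon>..1} (\<lambda>u. cos (\<psi> u - \<phi>))\<bar> \<le> K"
  shows "cmod (integral {0<..<1} (\<lambda>u. cis (\<psi> u))) \<le> K"
proof -
  define J where "J = integral {0<..<1} (\<lambda>u. cis (\<psi> u))"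
  define \<phi> where "\<phi> = Arg J"
  have "((\<lambda>u. cis (\<psi> u)) has_integral J) {0..1}"
    using integrable_integral[OF int] has_integral_open_interval[of "\<lambda>u. cis (\<psi> u)" J 0 1]
    by (simp add: J_def)
  then have "((\<lambda>u. cis (- \<phi>) * cis (\<psi> u)) has_integral cis (- \<phi>) * J) {0..1}"
    by (rule has_integral_mult_right)
  then have "((\<lambda>u. Re (cis (- \<phi>) * cis (\<psi> u))) has_integral Re (cis (- \<phi>) * J)) {0..1}"
    by (rule has_integral_Re)
  moreover have "cis (- \<phi>) * J = of_real (cmod J)"
  proof -
    have "J = of_real (cmod J) * cis \<phi>" using rcis_cmod_Arg[of J] by (simp add: rcis_def \<phi>_def)
    then have "cis (- \<phi>) * J = of_real (cmod J) * (cis (- \<phi>) * cis \<phi>)" by (metis mult.left_commute)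
    then show ?thesis by (simp add: cis_mult)
  qed
  ultimately have "((\<lambda>u. cos (\<psi> u - \<phi>)) has_integral cmod J) {0..1}"
    by (simp only: cis_mult Re_complex_of_real cis.sel) (simp add: add.commute)
  then have "\<bar>integral {0..1} (\<lambda>u. cos (\<psi> u - \<phi>))\<bar> = cmod J" "(\<lambda>u. cos (\<psi> u - \<phi>)) integrable_on {0..1}"
    by (auto simp: integral_unique)
  then show ?thesis
    using abs_integral_01_le_if_truncations_le[of "\<lambda>u. cos (\<psi> u - \<phi>)" K] K unfolding J_def by simp
qed

section \<open>Choice of coefficients and the final constant\<close>

theorem theorem2:
  fixes k :: nat
  assumes "k \<ge> 2"
  shows "\<exists>C>0. \<forall>(\<theta> :: nat \<Rightarrow> real) (\<tau> :: real) (\<beta> :: real) (\<rho> :: complex) (X :: real).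
           (real k + 1) / (real k + 2) \<le> \<beta> \<longrightarrow> \<beta> \<le> 1 \<longrightarrow> \<tau> \<noteq> 0 \<longrightarrow> \<theta> k \<noteq> 0 \<longrightarrow>
           \<rho> = of_real \<beta> + 2 * of_real pi * \<i> * of_real \<tau> \<longrightarrow> X \<ge> 1 \<longrightarrow>
           cmod (osc_integral k X \<theta> \<rho>)
             \<le> C * (X powr \<beta> / (1 + (\<Sum>j=1..k. X ^ j * \<bar>\<theta> j\<bar>) + \<bar>\<tau>\<bar>) powr (1 / (1 + real k)))"
proof -
  define C0 where "C0 = (real k + 1) * (6 * real k + 2)"
  have "1 \<le> C0" using assms by (auto simp: C0_def intro: mult_ge1_I)
  \<comment> \<open>In \<open>4 * C0\<close>, one factor 2 bounds \<open>1 / \<beta>\<close>, the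
    other comes from comparing \<open>S\<close> with \<open>L\<close>.\<close>
  have bound: "cmod (osc_integral k X \<theta> (of_real \<beta> + 2 * of_real pi * \<i> * of_real \<tau>))
      \<le> 4 * C0 * (X powr \<beta> / (1 + (\<Sum>j=1..k. X ^ j * \<bar>\<theta> j\<bar>) + \<bar>\<tau>\<bar>) powr (1 / (1 + real k)))"
    if \<beta>: "(real k + 1) / (real k + 2) \<le> \<beta>" "\<beta> \<le> 1" and nz: "\<tau> \<noteq> 0" "\<theta> k \<noteq> 0" and X: "1 \<le> X"
    for \<theta> :: "nat \<Rightarrow> real" and \<tau> \<beta> X :: real
  proof -
    \<comment> \<open>Up to the factor \<open>2 * pi / \<beta>\<close>, these are the coefficients
      of \<open>u\<close> times the derivative of \<open>\<psi>\<close>; the logarithm supplies the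
      term \<open>j = 0\<close>.\<close>
    define c where "c j = (if j = 0 then \<tau> else real j * (\<theta> j * X ^ j))" for j
    define L where "L = (\<Sum>j\<le>k. \<bar>c j\<bar>)"
    define S where "S = 1 + (\<Sum>j=1..k. X ^ j * \<bar>\<theta> j\<bar>) + \<bar>\<tau>\<bar>"
    define y where "y = L powr (- 1 / (1 + real k))"
    define \<psi> where "\<psi> u = 2 * pi * ((\<Sum>j=1..k. \<theta> j * X ^ j * u powr (real j / \<beta>))
      + \<tau> * (ln X + ln u / \<beta>))" for u
    have "(1::real) / 2 \<le> (real k + 1) / (real k + 2)" by (simp add: field_simps)
    then have \<beta>2: "1 / 2 \<le> \<beta>" using \<beta> by linarith
    have "real k / (real k + 1) \<le> (real k + 1) / (real k + 2)" by (simp add: field_simps)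
    then have "real k / (real k + 1) \<le> \<beta>" using \<beta> by linarith
    then have \<beta>k: "real k \<le> \<beta> * (real k + 1)" by (simp add: pos_divide_le_eq)
    have split: "(\<Sum>j\<le>k. a j) = a 0 + (\<Sum>j=1..k. a j)" for a :: "nat \<Rightarrow> real"
      by (simp add: atMost_atLeast0 sum.atLeast_Suc_atMost)
    have "S \<le> 1 + L"
    proof -
      have "(\<Sum>j=1..k. X ^ j * \<bar>\<theta> j\<bar>) \<le> (\<Sum>j=1..k. \<bar>c j\<bar>)"
      proof (rule sum_mono)
        fix j assume "j \<in> {1..k}"
        then have "1 * (X ^ j * \<bar>\<theta> j\<bar>) \<le> real j * (X ^ j * \<bar>\<theta> j\<bar>)"
          using X by (intro mult_right_mono) auto
        then show "X ^ j * \<bar>\<theta> j\<bar> \<le> \<bar>c j\<bar>"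
          using X \<open>j \<in> {1..k}\<close> by (simp add: c_def abs_mult mult_ac)
      qed
      then show ?thesis by (simp add: S_def L_def split c_def)
    qed
    have "0 < L" using nz by (simp add: L_def split c_def add_pos_nonneg sum_nonneg)
    then have "0 < y" by (simp add: y_def)
    have "y ^ (k + 1) = L powr (real (k + 1) * (- 1 / (1 + real k)))"
      using \<open>0 < L\<close> unfolding y_def by (intro powr_power) simp
    also have "real (k + 1) * (- 1 / (1 + real k)) = - 1" by (simp add: field_simps)
    also have "L powr (- 1) = 1 / L" using \<open>0 < L\<close> by (simp add: powr_minus_divide)
    finally have yL: "y ^ (k + 1) * L = 1" using \<open>0 < L\<close> by simp
    have "1 \<le> S" using X by (auto simp: S_def intro!: add_nonneg_nonneg sum_nonneg)

    note sub = osc_integral_substitution[where X = X and \<beta> = \<beta> and k = k and \<theta> = \<theta> and \<tau> = \<tau>, folded \<psi>_def]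
    have I: "(\<lambda>u. cis (\<psi> u)) integrable_on {0<..<1}"
      using sub(2) X \<beta>2 by (auto intro: set_lebesgue_integral_eq_integral(1))
    have trivial: "cmod (integral {0<..<1} (\<lambda>u. cis (\<psi> u))) \<le> 1"
    proof (rule norm_integral_cis_le[OF I])
      fix \<phi> \<epsilon> :: real assume \<epsilon>: "0 < \<epsilon>" "\<epsilon> \<le> 1"
      show "\<bar>integral {\<epsilon>..1} (\<lambda>u. cos (\<psi> u - \<phi>))\<bar> \<le> 1"
      \<comment> \<open>By convention the integral of a non-integrable function is 0, so the second
        case is immediate.\<close>
      proof (cases "(\<lambda>u. cos (\<psi> u - \<phi>)) integrable_on {\<epsilon>..1}")
        case True
        then have "norm (integral {\<epsilon>..1} (\<lambda>u. cos (\<psi> u - \<phi>))) \<le> integral {\<epsilon>..1} (\<lambda>_. 1)"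
          by (intro integral_norm_bound_integral) auto
        then show ?thesis using \<epsilon> by simp
      qed (simp add: not_integrable_integral)
    qed
    have decay: "cmod (integral {0<..<1} (\<lambda>u. cis (\<psi> u))) \<le> C0 * y"
    proof (rule norm_integral_cis_le[OF I])
      fix \<phi> \<epsilon> :: real assume \<epsilon>: "0 < \<epsilon>" "\<epsilon> \<le> 1"
      show "\<bar>integral {\<epsilon>..1} (\<lambda>u. cos (\<psi> u - \<phi>))\<bar> \<le> C0 * y"
        unfolding C0_def
      proof (rule cos_phase_integral_bound[of k c \<beta> y])
        show "c k \<noteq> 0" using nz X assms by (simp add: c_def)
        fix u :: real assume "0 < u"
        \<comment> \<open>The shift disappears on differentiation, which makes the estimate uniform
          in \<open>\<phi>\<close>.\<close>
        have "((\<lambda>u. \<psi> u - \<phi>) has_real_derivative 2 * pi *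
            ((\<Sum>j=1..k. \<theta> j * X ^ j * ((real j / \<beta>) * u powr (real j / \<beta> - 1)))
            + \<tau> * (0 + 1 / u / \<beta>)) - 0) (at u)"
          unfolding \<psi>_def using \<open>0 < u\<close>
          by (intro DERIV_diff DERIV_cmult DERIV_add DERIV_sum DERIV_const DERIV_cdivide
              has_real_derivative_powr DERIV_ln_divide) auto
        moreover have "2 * pi / \<beta> * (\<Sum>j\<le>k. c j * u powr (real j / \<beta> - 1)) = 2 * pi *
            ((\<Sum>j=1..k. \<theta> j * X ^ j * ((real j / \<beta>) * u powr (real j / \<beta> - 1)))
            + \<tau> * (0 + 1 / u / \<beta>)) - 0"
        proof -
          have "(\<Sum>j=1..k. c j * u powr (real j / \<beta> - 1))
              = \<beta> * (\<Sum>j=1..k. \<theta> j * X ^ j * ((real j / \<beta>) * u powr (real j / \<beta> - 1)))"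
            unfolding sum_distrib_left using \<beta>2 by (intro sum.cong) (auto simp: c_def)
          moreover have "c 0 * u powr (real 0 / \<beta> - 1) = \<beta> * (\<tau> * (1 / u / \<beta>))"
            using \<open>0 < u\<close> \<beta>2 by (simp add: c_def powr_minus field_simps)
          ultimately show ?thesis unfolding split using \<beta>2 by (simp add: field_simps)
        qed
        ultimately show "((\<lambda>u. \<psi> u - \<phi>) has_real_derivative
            2 * pi / \<beta> * (\<Sum>j\<le>k. c j * u powr (real j / \<beta> - 1))) (at u)" by simp
      qed (use assms \<beta> \<beta>2 \<beta>k \<epsilon> \<open>0 < y\<close> yL in \<open>auto simp: L_def\<close>)
    qed
    have main: "cmod (integral {0<..<1} (\<lambda>u. cis (\<psi> u))) \<le> 2 * C0 / S powr (1 / (1 + real k))"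
    proof -
      have two: "2 powr (1 / (1 + real k)) \<le> (2::real)"
        using powr_mono[of "1 / (1 + real k)" 1 "2::real"] by simp
      show ?thesis
      \<comment> \<open>For \<open>1 \<le> L\<close>, \<open>S\<close> is at most
        \<open>2 * L\<close> and the decay in \<open>y\<close> gives the claim. Otherwise
        \<open>y\<close> exceeds 1, but \<open>S\<close> is below 2 and the trivial bound
        suffices.\<close>
      proof (cases "1 \<le> L")
        case True
        then have "S powr (1 / (1 + real k)) \<le> (2 * L) powr (1 / (1 + real k))"
          using \<open>S \<le> 1 + L\<close> \<open>1 \<le> S\<close> by (intro powr_mono2) auto
        also have "\<dots> \<le> 2 * L powr (1 / (1 + real k))"
          using two True by (simp add: powr_mult mult_right_mono)
        finally have "y * S powr (1 / (1 + real k)) \<le> y * (2 * L powr (1 / (1 + real k)))"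
          using \<open>0 < y\<close> by simp
        also have "\<dots> = 2" using \<open>0 < L\<close> by (simp add: y_def flip: powr_add)
        finally have "y \<le> 2 / S powr (1 / (1 + real k))"
          using \<open>1 \<le> S\<close> by (simp add: pos_le_divide_eq)
        then have "C0 * y \<le> C0 * (2 / S powr (1 / (1 + real k)))"
          using \<open>1 \<le> C0\<close> by (intro mult_left_mono) auto
        then show ?thesis using decay by (simp add: mult.commute)
      next
        case False
        then have "S powr (1 / (1 + real k)) \<le> 2 powr (1 / (1 + real k))"
          using \<open>S \<le> 1 + L\<close> \<open>1 \<le> S\<close> by (intro powr_mono2) auto
        then have "S powr (1 / (1 + real k)) \<le> 2 * C0" using two \<open>1 \<le> C0\<close> by linarith
        then have "1 \<le> 2 * C0 / S powr (1 / (1 + real k))"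
          using \<open>1 \<le> S\<close> by (simp add: pos_le_divide_eq)
        then show ?thesis using trivial by linarith
      qed
    qed
    have "cmod (osc_integral k X \<theta> (of_real \<beta> + 2 * of_real pi * \<i> * of_real \<tau>))
        = X powr \<beta> / \<beta> * cmod (integral {0<..<1} (\<lambda>u. cis (\<psi> u)))"
      using sub(1) X \<beta>2 by (simp add: norm_mult norm_divide)
    also have "\<dots> \<le> (X powr \<beta> * 2) * (2 * C0 / S powr (1 / (1 + real k)))"
    proof (intro mult_mono main)
      have "X powr \<beta> * 1 \<le> X powr \<beta> * (2 * \<beta>)" using \<beta>2 by (intro mult_left_mono) auto
      then show "X powr \<beta> / \<beta> \<le> X powr \<beta> * 2" using \<beta>2 by (simp add: field_simps)
    qed auto
    finally show ?thesis by (simp add: S_def mult_ac)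
  qed
  show ?thesis
    using bound \<open>1 \<le> C0\<close> by (intro exI[of _ "4 * C0"]) auto
qed

end
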